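(* Let $r\geq 2$, $n\geq 2r+1$ and $k\geq 2$ be integers. Then $\gamma_{\times k}(K(n,r))=k+r$ if and only if $n\geq r(k+r)$.
   Context: The Kneser graph $K(n,r)$ has as vertices the $r$-subsets of $[n]=\{1,\dots,n\}$, two vertices adjacent iff disjoint. For a vertex $v$, $N[v]$ is its closed neighbourhood. A set $D$ of vertices is a $k$-tuple dominating set if $|N[v]\cap D|\geq k$ for every vertex $v$; $\gamma_{\times k}(K(n,r))$ is the minimum cardinality of such a set (defined when $k\leq \binom{n-r}{r}+1$). *)

theory Defs
  imports "Graph_Theory.Pair_Digraph" "HOL-Library.Extended_Nat"
begin

text \<open>As usual in Graph_Theory, a finite simple graph is a symmetric loop-free digraph
  (\<^locale>\<open>pair_graph\<close>), so each edge occurs as two arcs.\<close>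

definition kneser_graph :: "nat \<Rightarrow> nat \<Rightarrow> nat set pair_pre_digraph" where
  "kneser_graph n r =
    (let V = {A. A \<subseteq> {1..n} \<and> card A = r}
     in \<lparr> pverts = V, parcs = {(A, B). A \<in> V \<and> B \<in> V \<and> A \<inter> B = {}} \<rparr>)"

definition closed_neighbourhood :: "'a pair_pre_digraph \<Rightarrow> 'a \<Rightarrow> 'a set" where
  "closed_neighbourhood G v = insert v {u \<in> pverts G. (v, u) \<in> parcs G}"

definition tuple_dominating :: "'a pair_pre_digraph \<Rightarrow> nat \<Rightarrow> 'a set \<Rightarrow> bool" where
  "tuple_dominating G k D \<longleftrightarrow>
    D \<subseteq> pverts G \<and> (\<forall>v \<in> pverts G. k \<le> card (closed_neighbourhood G v \<inter> D))"

text \<open>Meant for finite graphs. The infimum is a minimum if a \<open>k\<close>-tuple dominating set exists;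
  otherwise the number is undefined in the literature and \<open>\<infinity>\<close> here.\<close>

definition tuple_domination_number :: "nat \<Rightarrow> 'a pair_pre_digraph \<Rightarrow> enat"
    ("\<gamma>\<^sub>\<times>") where
  "\<gamma>\<^sub>\<times> k G = (INF D \<in> {D. tuple_dominating G k D}. enat (card D))"

lemma tuple_domination_number_eq_enat_iff:
  "\<gamma>\<^sub>\<times> k G = enat m \<longleftrightarrow>
    (\<exists>D. tuple_dominating G k D \<and> card D = m) \<and> (\<forall>D. tuple_dominating G k D \<longrightarrow> m \<le> card D)"
proof (cases "\<exists>D. tuple_dominating G k D")
  case False
  then show ?thesis
    by (auto simp: tuple_domination_number_def top_enat_def)
next
  case True
  let ?S = "(\<lambda>D. enat (card D)) ` {D. tuple_dominating G k D}"
  have ne: "?S \<noteq> {}" using True by blast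
  then have "\<exists>x. x \<in> ?S" by blast
  then have "(LEAST x. x \<in> ?S) \<in> ?S" by (rule LeastI_ex)
  with ne have "Inf ?S \<in> ?S" unfolding Inf_enat_def by (simp only: if_False)
  then obtain D where D: "tuple_dominating G k D" "\<gamma>\<^sub>\<times> k G = enat (card D)"
    unfolding tuple_domination_number_def by (elim imageE) simp
  have le: "card D \<le> card D'" if "tuple_dominating G k D'" for D'
    using that D(2) INF_lower[of D' "{D. tuple_dominating G k D}" "\<lambda>D. enat (card D)"]
    by (simp add: tuple_domination_number_def)
  show ?thesis
  proof
    assume "\<gamma>\<^sub>\<times> k G = enat m"
    then have "card D = m" using D(2) by simp
    then show "(\<exists>D. tuple_dominating G k D \<and> card D = m) \<and>
        (\<forall>D. tuple_dominating G k D \<longrightarrow> m \<le> card D)"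
      using D(1) le by blast
  next
    assume "(\<exists>D. tuple_dominating G k D \<and> card D = m) \<and>
        (\<forall>D. tuple_dominating G k D \<longrightarrow> m \<le> card D)"
    then have "card D = m" using D(1) le order_antisym by blast
    then show "\<gamma>\<^sub>\<times> k G = enat m" using D(2) by simp
  qed
qed

lemma pair_graph_kneser_graph:
  assumes "r \<ge> 1"
  shows "pair_graph (kneser_graph n r)"
proof -
  let ?G = "kneser_graph n r"
  have fin: "finite (pverts ?G)"
    by (rule finite_subset[of _ "Pow {1..n}"]) (auto simp: kneser_graph_def)
  have sub: "parcs ?G \<subseteq> pverts ?G \<times> pverts ?G"
    by (auto simp: kneser_graph_def)
  have sym: "sym (parcs ?G)"
    by (rule symI) (auto simp: kneser_graph_def)
  have loopfree: "fst e \<noteq> snd e" if "e \<in> parcs ?G" for e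
    using that assms by (cases e) (auto simp: kneser_graph_def)
  show ?thesis
  proof unfold_locales
    show "finite (parcs ?G)" using finite_subset[OF sub] fin by simp
    show "symmetric (with_proj ?G)" using sym by (simp add: symmetric_def)
  qed (use fin sub loopfree in auto)
qed

lemma card_closed_neighbourhood_kneser:
  assumes "r \<ge> 1" "v \<in> pverts (kneser_graph n r)"
  shows "card (closed_neighbourhood (kneser_graph n r) v) = ((n - r) choose r) + 1"
proof -
  have v: "v \<subseteq> {1..n}" "card v = r" "finite v"
    using assms finite_subset[of v "{1..n}"] by (auto simp: kneser_graph_def Let_def)
  let ?N = "{A. A \<subseteq> {1..n} - v \<and> card A = r}"
  have fin: "finite ?N" by (rule finite_subset[of _ "Pow {1..n}"]) auto
  have "v \<noteq> {}" using v(2) assms(1) by auto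
  then have "v \<notin> ?N" by auto
  moreover have "closed_neighbourhood (kneser_graph n r) v = insert v ?N"
    using v by (auto simp: closed_neighbourhood_def kneser_graph_def Let_def)
  moreover have "card ?N = ((n - r) choose r)"
    using n_subsets[of "{1..n} - v" r] v by (simp add: card_Diff_subset)
  ultimately show ?thesis using fin by simp
qed

lemma tuple_domination_number_kneser_finite_iff:
  assumes "r \<ge> 1" "n \<ge> r"
  shows "\<gamma>\<^sub>\<times> k (kneser_graph n r) \<noteq> \<infinity> \<longleftrightarrow> k \<le> ((n - r) choose r) + 1"
proof
  let ?G = "kneser_graph n r"
  have fin: "finite (closed_neighbourhood ?G v)" if "v \<in> pverts ?G" for v
    using card_closed_neighbourhood_kneser[OF assms(1) that] by (intro card_ge_0_finite) simp
  assume "\<gamma>\<^sub>\<times> k ?G \<noteq> \<infinity>"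
  then obtain D where D: "tuple_dominating ?G k D"
    by (auto simp: tuple_domination_number_eq_enat_iff)
  have v: "{1..r} \<in> pverts ?G" using assms by (auto simp: kneser_graph_def Let_def)
  have "k \<le> card (closed_neighbourhood ?G {1..r} \<inter> D)"
    using D v by (auto simp: tuple_dominating_def)
  also have "\<dots> \<le> card (closed_neighbourhood ?G {1..r})"
    by (intro card_mono fin v) auto
  finally show "k \<le> ((n - r) choose r) + 1"
    by (simp only: card_closed_neighbourhood_kneser[OF assms(1) v])
next
  let ?G = "kneser_graph n r"
  assume k: "k \<le> ((n - r) choose r) + 1"
  have "closed_neighbourhood ?G v \<inter> pverts ?G = closed_neighbourhood ?G v"
    if "v \<in> pverts ?G" for v
    using that by (auto simp: closed_neighbourhood_def)
  then have "tuple_dominating ?G k (pverts ?G)"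
    using k card_closed_neighbourhood_kneser[OF assms(1)] by (auto simp: tuple_dominating_def)
  then have "\<gamma>\<^sub>\<times> k ?G \<le> enat (card (pverts ?G))"
    by (auto simp: tuple_domination_number_def intro: INF_lower)
  then show "\<gamma>\<^sub>\<times> k ?G \<noteq> \<infinity>"
    using enat_ord_code(5) by metis
qed

end

theory Submission
  imports Defs
begin

text \<open>
  A set \<open>D\<close> of vertices is \<open>k\<close>-tuple dominating iff every vertex \<open>v\<close> meets at most \<open>|D| - k\<close>
  members of \<open>D\<close>, or at most \<open>|D| - k + 1\<close> if \<open>v \<in> D\<close>.  Pairwise disjoint \<open>r\<close>-sets thus
  form a dominating set when \<open>|D| = k + r\<close>.  Conversely, a set of at most \<open>r\<close> points can be
  extended greedily so that each new point meets a new member of \<open>D\<close>.  This yields a vertex meeting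
  too many members if \<open>|D| < k + r\<close>, and also if \<open>|D| = k + r\<close> and two members share a point,
  after an exchange argument that excludes that the vertex obtained lies in \<open>D\<close>.  So \<open>k + r\<close>
  vertices dominate only if they are pairwise disjoint, which needs \<open>r (k + r)\<close> points.
\<close>

section \<open>Set families and how many of their members a set meets\<close>

definition hits :: "'a set set \<Rightarrow> 'a set \<Rightarrow> 'a set set" where
  "hits F v = {A \<in> F. A \<inter> v \<noteq> {}}"

lemma finite_hits: "finite F \<Longrightarrow> finite (hits F v)"
  by (simp add: hits_def)

lemma hits_singleton: "hits F {x} = {A \<in> F. x \<in> A}"
  by (auto simp: hits_def)

text \<open>A point lies in at most one member of a disjoint family, so picking a point of
  \<open>A \<inter> v\<close> for each member \<open>A\<close> that \<open>v\<close> meets is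
  injective.\<close>

lemma card_hits_le_card:
  assumes "pairwise disjnt F" "finite v"
  shows "card (hits F v) \<le> card v"
proof -
  have "\<exists>x. x \<in> A \<inter> v" if "A \<in> hits F v" for A
    using that by (auto simp: hits_def)
  then obtain f where f: "\<And>A. A \<in> hits F v \<Longrightarrow> f A \<in> A \<inter> v"
    by metis
  have "inj_on f (hits F v)"
  proof (rule inj_onI)
    fix A B assume AB: "A \<in> hits F v" "B \<in> hits F v" "f A = f B"
    then have "\<not> disjnt A B" using f[of A] f[of B] by (auto simp: disjnt_iff)
    then show "A = B" using AB assms(1) by (auto simp: hits_def pairwise_def)
  qed
  moreover have "f ` hits F v \<subseteq> v" using f by auto
  ultimately show ?thesis using assms(2) card_inj_on_le by blast
qed

lemma extend_hits:
  assumes "finite X" "finite F" "\<And>A. A \<in> F \<Longrightarrow> A \<subseteq> X \<and> A \<noteq> {}"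
    and "v \<subseteq> X" "card v \<le> r" "r \<le> card X"
  shows "\<exists>w. v \<subseteq> w \<and> w \<subseteq> X \<and> card w = r \<and>
    min (card F) (card (hits F v) + (r - card v)) \<le> card (hits F w)"
  using assms(4,5)
proof (induction "r - card v" arbitrary: v)
  case 0
  then show ?case by (intro exI[of _ v]) auto
next
  case (Suc d)
  have fv: "finite v" using Suc.prems(1) assms(1) finite_subset by blast
  have lt: "card v < r" using Suc.hyps(2) by linarith
  obtain x where x: "x \<in> X" "x \<notin> v"
    and min: "min (card F) (card (hits F v) + 1) \<le> card (hits F (insert x v))"
  proof (cases "hits F v = F")
    case True
    have "v \<noteq> X" using lt assms(6) by auto
    then obtain x where x: "x \<in> X" "x \<notin> v" using Suc.prems(1) by blast
    have "hits F v \<subseteq> hits F (insert x v)" by (auto simp: hits_def)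
    then have "card F \<le> card (hits F (insert x v))"
      using True assms(2) by (metis card_mono finite_hits)
    then show thesis using x that by fastforce
  next
    case False
    then obtain A where A: "A \<in> F" "A \<inter> v = {}" by (auto simp: hits_def)
    then obtain x where x: "x \<in> A" using assms(3) by blast
    have "insert A (hits F v) \<subseteq> hits F (insert x v)"
      using A x by (auto simp: hits_def)
    then have "card (insert A (hits F v)) \<le> card (hits F (insert x v))"
      by (intro card_mono finite_hits assms(2))
    moreover have "A \<notin> hits F v" using A by (simp add: hits_def)
    ultimately have "card (hits F v) + 1 \<le> card (hits F (insert x v))"
      using assms(2) by (simp add: finite_hits)
    moreover have "x \<in> X" "x \<notin> v" using A x assms(3) by auto
    ultimately show thesis using that by fastforce
  qed
  have c: "card (insert x v) = Suc (card v)" using fv x by simp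
  obtain w where "insert x v \<subseteq> w" "w \<subseteq> X" "card w = r"
    "min (card F) (card (hits F (insert x v)) + (r - card (insert x v))) \<le> card (hits F w)"
  proof -
    have "d = r - card (insert x v)" "insert x v \<subseteq> X" "card (insert x v) \<le> r"
      using Suc.hyps(2) Suc.prems x c lt by auto
    from Suc.hyps(1)[OF this] show thesis using that by blast
  qed
  then show ?case
    using min c lt by (intro exI[of _ w]) auto
qed

text \<open>The bounds \<open>le\<close> and \<open>le'\<close> express domination when
  \<open>card F = k + r\<close>. Starting from a point of two members gains one extra hit, which
  only a member of \<open>F\<close> may have; exchanging points of that member then violates
  \<open>le\<close>.\<close>

lemma pairwise_disjnt_if_card_hits_le:
  assumes X: "finite X" "r \<le> card X" and r: "r \<ge> 2"
    and F: "finite F" "\<And>A. A \<in> F \<Longrightarrow> A \<subseteq> X \<and> A \<noteq> {}" "card F \<ge> r + 2"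
    and le: "\<And>v. v \<subseteq> X \<Longrightarrow> card v = r \<Longrightarrow> card (hits F v) \<le> r + 1"
    and le': "\<And>v. v \<subseteq> X \<Longrightarrow> card v = r \<Longrightarrow> v \<notin> F \<Longrightarrow> card (hits F v) \<le> r"
  shows "pairwise disjnt F"
proof (rule ccontr)
  assume "\<not> pairwise disjnt F"
  then obtain A B x where AB: "A \<in> F" "B \<in> F" "A \<noteq> B" and xAB: "x \<in> A" "x \<in> B"
    by (auto simp: pairwise_def disjnt_iff)
  \<comment> \<open>Three members through \<open>y\<close>, extended by \<open>r - 1\<close> further
    points, would give \<open>r + 2\<close> hits, against \<open>le\<close>;
    \<open>card F \<ge> r + 2\<close> keeps the minimum from cutting this off.\<close>
  have deg: "card (hits F {y}) \<le> 2" if "y \<in> X" for y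
  proof -
    obtain w where "w \<subseteq> X" "card w = r" "min (card F) (card (hits F {y}) + (r - 1)) \<le> card (hits F w)"
      using extend_hits[OF X(1) F(1,2), of "{y}" r] X(2) r \<open>y \<in> X\<close> by auto
    then show ?thesis using le[of w] F(3) r by linarith
  qed
  have pair: "hits F {y} = {P, Q}"
    if "P \<in> F" "Q \<in> F" "P \<noteq> Q" "y \<in> P" "y \<in> Q" for P Q y
  proof -
    have sub: "{P, Q} \<subseteq> hits F {y}" using that by (auto simp: hits_def)
    have "y \<in> X" using that F(2) by blast
    then have "card (hits F {y}) \<le> card {P, Q}" using deg[of y] that(3) by simp
    then show ?thesis using card_seteq[OF finite_hits[OF F(1)] sub] by simp
  qed
  have xX: "x \<in> X" using AB xAB F(2) by blast
  have "card (hits F {x}) = 2" using pair[OF AB xAB] AB(3) by simp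
  \<comment> \<open>Two hits at \<open>x\<close> and one for each of the other \<open>r - 1\<close>
    points.\<close>
  then obtain v where v: "x \<in> v" "v \<subseteq> X" "card v = r" and hv: "r + 1 \<le> card (hits F v)"
    using extend_hits[OF X(1) F(1,2), of "{x}" r] X(2) r xX F(3) by auto
  have fv: "finite v" using v X finite_subset by blast
  have vF: "v \<in> F" using le'[OF v(2,3)] hv by linarith
  have "card (hits F v) < card F" using le[OF v(2,3)] F(3) by linarith
  then obtain C where C: "C \<in> F" "C \<inter> v = {}"
    by (metis (mono_tags, lifting) hits_def less_irrefl mem_Collect_eq subsetI subset_antisym)
  then obtain c where c: "c \<in> C" "c \<in> X" "c \<notin> v" using F(2) by blast
  obtain b where b: "b \<in> v" "b \<noteq> x"
  proof -
    have "v \<noteq> {x}" using v(3) r by auto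
    then show thesis using that v(1) by blast
  qed
  have swap: "insert c (v - {y}) \<subseteq> X" "card (insert c (v - {y})) = r" if "y \<in> v" for y
    using that v c fv r by (auto simp: card_Diff_singleton)
  define v' where "v' = insert c (v - {b})"
  \<comment> \<open>Replacing \<open>b\<close> by \<open>c\<close> gains \<open>C\<close>. It loses
    at most one member: by \<open>deg\<close> only one besides \<open>v\<close> contains
    \<open>b\<close>, and \<open>v\<close> itself is still met in \<open>x\<close>. So
    \<open>v'\<close> also has \<open>r + 1\<close> hits, which \<open>le'\<close> allows only
    inside \<open>F\<close>.\<close>
  have v'F: "v' \<in> F"
  proof (rule ccontr)
    assume "v' \<notin> F"
    then have le_r: "card (hits F v') \<le> r" using le' swap[OF b(1)] by (simp add: v'_def)
    have "hits F v - (hits F {b} - {v}) \<union> {C} \<subseteq> hits F v'"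
      using v b c C vF by (auto simp: hits_def v'_def)
    then have "card (hits F v - (hits F {b} - {v}) \<union> {C}) \<le> card (hits F v')"
      by (intro card_mono finite_hits F(1))
    moreover have "card (hits F v - (hits F {b} - {v}) \<union> {C}) =
        Suc (card (hits F v - (hits F {b} - {v})))"
      using C F(1) by (subst card_Un_disjoint) (auto simp: hits_def)
    moreover have "card (hits F v) - card (hits F {b} - {v}) \<le> card (hits F v - (hits F {b} - {v}))"
      by (intro diff_card_le_card_Diff finite_Diff finite_hits F(1))
    moreover have "card (hits F {b} - {v}) \<le> 1"
      using deg[of b] b(1) v(2) vF finite_hits[OF F(1), of "{b}"]
      by (subst card_Diff_singleton) (auto simp: hits_def)
    ultimately show False using le_r hv by linarith
  qed
  have "v \<noteq> v'" using c by (auto simp: v'_def)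
  then have hx: "hits F {x} = {v, v'}"
    using pair[OF vF v'F] v(1) b by (simp add: v'_def)
  define u where "u = insert c (v - {x})"
  \<comment> \<open>Only \<open>v\<close> and \<open>v'\<close> could be lost with \<open>x\<close>, but \<open>u\<close> meets them in \<open>b\<close> and \<open>c\<close>.\<close>
  have "insert C (hits F v) \<subseteq> hits F u"
  proof
    fix P assume "P \<in> insert C (hits F v)"
    then consider "P = C" | "P \<in> F" "x \<in> P" | "P \<in> F" "P \<inter> (v - {x}) \<noteq> {}"
      by (auto simp: hits_def)
    then show "P \<in> hits F u"
    proof cases
      case 1
      then show ?thesis using C c by (auto simp: hits_def u_def)
    next
      case 2
      then have "P = v \<or> P = v'" using hx by (auto simp: hits_singleton)
      then show ?thesis using b vF v'F by (auto simp: hits_def u_def v'_def)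
    next
      case 3
      then show ?thesis by (auto simp: hits_def u_def)
    qed
  qed
  then have "card (insert C (hits F v)) \<le> card (hits F u)"
    by (intro card_mono finite_hits F(1))
  moreover have "C \<notin> hits F v" using C by (simp add: hits_def)
  ultimately have "r + 2 \<le> card (hits F u)" using hv F(1) by (simp add: finite_hits)
  then show False using le[of u] swap[OF v(1)] by (simp add: u_def)
qed

section \<open>Domination in Kneser graphs\<close>

lemma pverts_kneser_graph: "pverts (kneser_graph n r) = {A. A \<subseteq> {1..n} \<and> card A = r}"
  by (simp add: kneser_graph_def Let_def)

lemma finite_pverts_kneser_graph: "finite (pverts (kneser_graph n r))"
  by (rule finite_subset[of _ "Pow {1..n}"]) (auto simp: pverts_kneser_graph)

text \<open>A member of \<open>D\<close> is either disjoint from \<open>v\<close>, hence a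
  neighbour, or counted in \<open>hits D v\<close>. Only \<open>v\<close> itself, being nonempty,
  can be counted twice.\<close>

lemma card_closed_neighbourhood_inter:
  assumes "r \<ge> 1" "D \<subseteq> pverts (kneser_graph n r)" "v \<in> pverts (kneser_graph n r)"
  shows "card (closed_neighbourhood (kneser_graph n r) v \<inter> D) + card (hits D v) =
    card D + of_bool (v \<in> D)"
proof -
  let ?N = "closed_neighbourhood (kneser_graph n r) v \<inter> D"
  have fin: "finite D" using assms(2) finite_pverts_kneser_graph finite_subset by blast
  have "v \<noteq> {}" using assms(1,3) by (auto simp: pverts_kneser_graph)
  then have "?N \<inter> hits D v = {v} \<inter> D" and "?N \<union> hits D v = D"
    using assms(2,3)
    by (auto simp: closed_neighbourhood_def kneser_graph_def Let_def hits_def)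
  then show ?thesis using card_Un_Int[of ?N "hits D v"] fin by (simp add: finite_hits)
qed

lemma tuple_dominating_kneser_iff:
  assumes "r \<ge> 1"
  shows "tuple_dominating (kneser_graph n r) k D \<longleftrightarrow>
    D \<subseteq> pverts (kneser_graph n r) \<and>
    (\<forall>v \<in> pverts (kneser_graph n r). k + card (hits D v) \<le> card D + of_bool (v \<in> D))"
  using card_closed_neighbourhood_inter[OF assms]
  unfolding tuple_dominating_def by (metis add_le_cancel_right)

lemma card_tuple_dominating_kneser_ge:
  assumes "r \<ge> 2" "n \<ge> r" "k \<ge> 2" "tuple_dominating (kneser_graph n r) k D"
  shows "k + r \<le> card D"
proof (rule ccontr)
  assume "\<not> k + r \<le> card D"
  then have lt: "card D < k + r" by simp
  have D: "D \<subseteq> pverts (kneser_graph n r)"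
    and dom: "\<And>v. v \<in> pverts (kneser_graph n r) \<Longrightarrow> k + card (hits D v) \<le> card D + of_bool (v \<in> D)"
    using assms(1,4) by (auto simp: tuple_dominating_kneser_iff)
  have fin: "finite D" using D finite_pverts_kneser_graph finite_subset by blast
  have mem: "A \<subseteq> {1..n} \<and> A \<noteq> {}" if "A \<in> D" for A
    using that D assms(1) by (auto simp: pverts_kneser_graph)
  obtain v where v: "v \<in> pverts (kneser_graph n r)" and hv: "min (card D) r \<le> card (hits D v)"
    using extend_hits[of "{1..n}" D "{}" r] fin mem assms(2)
    by (fastforce simp: pverts_kneser_graph)
  \<comment> \<open>If \<open>v\<close> met all of \<open>D\<close>, the condition would leave
    \<open>k \<le> 1\<close>. So \<open>v\<close> has at least \<open>r\<close> hits, which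
    \<open>card D < k + r\<close> permits only for \<open>v \<in> D\<close> and
    \<open>card D = k + r - 1\<close>.\<close>
  have vD: "v \<in> D"
    using dom[OF v] hv lt assms(3) by (cases "v \<in> D") (auto simp: min_def split: if_splits)
  then have D_eq: "card D = k + r - 1"
    using dom[OF v] hv lt assms(3) by (auto simp: min_def split: if_splits)
  \<comment> \<open>As \<open>r \<ge> 2\<close>, \<open>v\<close> meets a member other than itself;
    a common point starts a second extension with two hits.\<close>
  have "\<not> hits D v \<subseteq> {v}"
    using hv D_eq assms(1,3) card_mono[of "{v}" "hits D v"] by (auto simp: min_def split: if_splits)
  then obtain A x where A: "A \<in> D" "A \<noteq> v" "x \<in> A" "x \<in> v" by (auto simp: hits_def)
  have "{A, v} \<subseteq> hits D {x}" using A vD by (auto simp: hits_def)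
  then have "card {A, v} \<le> card (hits D {x})" by (intro card_mono finite_hits fin)
  then have "2 \<le> card (hits D {x})" using A by simp
  moreover have "x \<in> {1..n}" using A mem by blast
  \<comment> \<open>Here \<open>card D = k + r - 1 \<ge> r + 1\<close>, so the minimum does not cut
    off the \<open>r + 1\<close> hits.\<close>
  ultimately obtain w where w: "w \<in> pverts (kneser_graph n r)" and hw: "r + 1 \<le> card (hits D w)"
    using extend_hits[of "{1..n}" D "{x}" r] fin mem assms D_eq
    by (fastforce simp: pverts_kneser_graph)
  have "of_bool (w \<in> D) \<le> (1::nat)" by simp
  then show False using dom[OF w] hw lt by linarith
qed

section \<open>Disjoint blocks and the equivalence\<close>

lemma ex_disjoint_subsets:
  assumes "r \<ge> 1" "m * r \<le> n"
  obtains D where "D \<subseteq> {A. A \<subseteq> {1..n} \<and> card A = r}" "card D = m" "pairwise disjnt D"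
proof -
  define f where "f i = {i * r + 1..i * r + r}" for i
  have disj: "disjnt (f i) (f j)" if "i < j" for i j
  proof -
    have "Suc i * r \<le> j * r" using that by (intro mult_right_mono) auto
    then show ?thesis by (auto simp: f_def disjnt_iff)
  qed
  have disj': "disjnt (f i) (f j)" if "i \<noteq> j" for i j
    using that disj[of i j] disj[of j i] by (auto simp: disjnt_sym neq_iff)
  have card_f: "card (f i) = r" for i by (simp add: f_def)
  have ne: "f i \<noteq> {}" for i using assms(1) by (simp add: f_def)
  \<comment> \<open>Equal blocks with different indices would be disjoint from themselves, hence
    empty.\<close>
  have "inj f"
    using disj' ne by (metis disjnt_self_iff_empty injI)
  then have "card (f ` {..<m}) = m" by (simp add: card_image inj_on_subset)
  moreover have "f i \<subseteq> {1..n}" if "i < m" for i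
  proof -
    have "Suc i * r \<le> m * r" using that by (intro mult_right_mono) auto
    then show ?thesis using assms(2) by (fastforce simp: f_def)
  qed
  then have "f ` {..<m} \<subseteq> {A. A \<subseteq> {1..n} \<and> card A = r}"
    using card_f by blast
  moreover have "pairwise disjnt (f ` {..<m})"
    unfolding pairwise_image by (rule pairwiseI) (use disj' in blast)
  ultimately show thesis using that by blast
qed

theorem theorem11:
  fixes n r k :: nat
  assumes "r \<ge> 2" and "n \<ge> 2 * r + 1" and "k \<ge> 2"
  shows "\<gamma>\<^sub>\<times> k (kneser_graph n r) = enat (k + r) \<longleftrightarrow> n \<ge> r * (k + r)"
proof
  let ?G = "kneser_graph n r"
  assume "\<gamma>\<^sub>\<times> k ?G = enat (k + r)"
  then obtain D where "tuple_dominating ?G k D" and card_D: "card D = k + r"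
    by (auto simp: tuple_domination_number_eq_enat_iff)
  then have D: "D \<subseteq> pverts ?G"
    and dom: "\<And>v. v \<in> pverts ?G \<Longrightarrow> card (hits D v) \<le> r + of_bool (v \<in> D)"
    using assms(1) by (auto simp: tuple_dominating_kneser_iff)
  have fin: "finite D" using D finite_pverts_kneser_graph finite_subset by blast
  have mem: "A \<subseteq> {1..n} \<and> card A = r" if "A \<in> D" for A
    using that D by (auto simp: pverts_kneser_graph)
  have "pairwise disjnt D"
  \<comment> \<open>The required \<open>card D \<ge> r + 2\<close> comes from
    \<open>k \<ge> 2\<close>.\<close>
  proof (rule pairwise_disjnt_if_card_hits_le[of "{1..n}" r])
    fix v assume v: "v \<subseteq> {1..n}" "card v = r"
    then have le: "card (hits D v) \<le> r + of_bool (v \<in> D)"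
      by (intro dom) (simp add: pverts_kneser_graph)
    then show "card (hits D v) \<le> r + 1" by (simp add: of_bool_def split: if_splits)
    show "card (hits D v) \<le> r" if "v \<notin> D" using le that by simp
  next
    fix A assume "A \<in> D"
    then show "A \<subseteq> {1..n} \<and> A \<noteq> {}" using mem[of A] assms(1) by auto
  qed (use assms fin card_D in auto)
  then have "card (\<Union>D) = (\<Sum>A\<in>D. card A)"
    by (intro card_Union_disjoint) (use mem finite_subset in blast)+
  also have "\<dots> = r * (k + r)" using mem card_D by simp
  finally have "r * (k + r) = card (\<Union>D)" by simp
  also have "\<dots> \<le> card {1..n}" by (intro card_mono) (use mem in auto)
  finally show "n \<ge> r * (k + r)" by simp
next
  let ?G = "kneser_graph n r"
  assume "n \<ge> r * (k + r)"
  then obtain D where D: "D \<subseteq> pverts ?G" "card D = k + r" "pairwise disjnt D"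
    using ex_disjoint_subsets[of r "k + r" n] assms(1)
    by (auto simp: pverts_kneser_graph mult.commute)
  \<comment> \<open>With \<open>card D = k + r\<close>, at most \<open>r\<close> hits leave
    \<open>k\<close> members in the closed neighbourhood, whether or not
    \<open>v \<in> D\<close>.\<close>
  have "card (hits D v) \<le> r" if "v \<in> pverts ?G" for v
    using card_hits_le_card[OF D(3), of v] that finite_subset[of v "{1..n}"]
    by (auto simp: pverts_kneser_graph)
  then have "tuple_dominating ?G k D"
    using D assms(1) by (simp add: tuple_dominating_kneser_iff trans_le_add1)
  then show "\<gamma>\<^sub>\<times> k ?G = enat (k + r)"
    using D(2) card_tuple_dominating_kneser_ge[of r n k] assms
    by (auto simp: tuple_domination_number_eq_enat_iff)
qed

end
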